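(* Let $W$ be the meromorphic function on $\mathbb{C}$ given by $W(s)=2^s\pi^{s-1}\sin\left(\frac{\pi s}{2}\right)\Gamma(1-s)$. The set of zeros of $W$, namely $\{-2n : n=0,1,2,\dots\}$, contains all the trivial zeros of the Riemann zeta function $\zeta$, and it contains no nontrivial zero of $\zeta$.
   Context: $\zeta$ denotes the Riemann zeta function, meromorphically continued to $\mathbb{C}$. The trivial zeros of $\zeta$ are $s=-2n$, $n=1,2,3,\dots$; all other zeros of $\zeta$ are called nontrivial. $W$ is regarded as a meromorphic function, with removable singularities removed. *)

theory Defs
  imports "HOL-Complex_Analysis.Complex_Analysis"
begin

text \<open>
  The Riemann zeta function is the meromorphic continuation of its Dirichlet series. A nicely
  meromorphic function is continuous off its poles and has value 0 at every pole, so by the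
  identity theorem at most one function satisfies the description below.
\<close>

definition riemann_zeta :: "complex \<Rightarrow> complex" where
  "riemann_zeta = (THE f. f nicely_meromorphic_on UNIV \<and>
     (\<forall>s. Re s > 1 \<longrightarrow> f s = (\<Sum>n. 1 / of_nat (Suc n) powr s)))"

text \<open>
  The requirement of analyticity excludes the poles, where a nicely meromorphic function also
  takes the value 0.
\<close>

definition zeros :: "(complex \<Rightarrow> complex) \<Rightarrow> complex set" where
  "zeros f = {z. f analytic_on {z} \<and> f z = 0}"

definition trivial_zeta_zeros :: "complex set" where
  "trivial_zeta_zeros = {- 2 * of_nat n | n :: nat. n \<ge> 1}"

definition nontrivial_zeta_zeros :: "complex set" where
  "nontrivial_zeta_zeros = zeros riemann_zeta - trivial_zeta_zeros"

text \<open>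
  At \<open>s = 2, 4, 6, \<dots>\<close> the pole of \<open>Gamma (1 - s)\<close> is cancelled by the zero of the sine;
  \<open>remove_sings\<close> puts in the limit there, whereas the bare formula has value 0, because
  \<open>Gamma\<close> is 0 at its poles by convention.
\<close>

definition W :: "complex \<Rightarrow> complex" where
  "W = remove_sings (\<lambda>s. 2 powr s * of_real pi powr (s - 1) * sin (of_real pi * s / 2) * Gamma (1 - s))"

lemma W_nicely_meromorphic: "W nicely_meromorphic_on UNIV"
proof -
  have "(\<lambda>s. inverse (rGamma (1 - s))) meromorphic_on UNIV"
    by (intro meromorphic_intros analytic_on_imp_meromorphic_on analytic_intros)
  moreover have "(\<lambda>s. 2 powr s * of_real pi powr (s - 1) * sin (of_real pi * s / 2) :: complex)
      meromorphic_on UNIV"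
    by (intro analytic_on_imp_meromorphic_on analytic_intros) (auto simp: complex_nonpos_Reals_iff not_le)
  ultimately have "(\<lambda>s. 2 powr s * of_real pi powr (s - 1) * sin (of_real pi * s / 2) *
      inverse (rGamma (1 - s)) :: complex) meromorphic_on UNIV"
    by (rule meromorphic_on_mult[rotated])
  then show ?thesis
    unfolding W_def Gamma_def by (intro remove_sings_nicely_meromorphic)
qed

end

(* Everything but the value at 0 is a matter of the zeros of W, so the point is that zeta(0) = -1/2
   is not 0. The m-th finite difference of x powr (-s) is of size x powr (-Re s - m), so repeated
   Euler transformation continues the alternating series eta(s) = (1 - 2 powr (1 - s)) * zeta(s) to
   an entire function; at s = 0 all differences of order at least 1 vanish, whence eta(0) = 1/2. *)

theory Submission
  imports Defs
begin

section \<open>Finite differences of \<open>x powr (-s)\<close> and their decay\<close>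

fun powr_fdiff :: "nat \<Rightarrow> complex \<Rightarrow> real \<Rightarrow> complex" where
  "powr_fdiff 0 s x = of_real x powr (-s)"
| "powr_fdiff (Suc m) s x = powr_fdiff m s x - powr_fdiff m s (x + 1)"

text \<open>Differencing in \<open>x\<close> commutes with differentiation in \<open>x\<close>, so
  the rule for \<open>x powr (-s)\<close> survives at every order. The order stays \<open>m\<close>
  while \<open>s\<close> moves to \<open>s + 1\<close>, which makes the induction for the size bound
  possible.\<close>

lemma has_vector_derivative_powr_fdiff:
  assumes "x > 0"
  shows "(powr_fdiff m s has_vector_derivative (- s * powr_fdiff m (s + 1) x)) (at x within X)"
  using assms
proof (induction m arbitrary: x X)
  case 0
  have "((\<lambda>z. z powr (-s)) has_field_derivative (- s * of_real x powr (- s - 1))) (at (of_real x))"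
    using 0 by (intro has_field_derivative_powr) auto
  from has_vector_derivative_real_field[OF this, of X]
  show ?case by (simp add: minus_diff_commute)
next
  case (Suc m)
  have shift: "((\<lambda>y::real. y + 1) has_vector_derivative 1) (at x within X)"
    by (auto intro!: derivative_eq_intros simp: has_vector_derivative_def)
  have "(powr_fdiff m s \<circ> (\<lambda>y. y + 1) has_vector_derivative 1 *\<^sub>R (- s * powr_fdiff m (s + 1) (x + 1)))
      (at x within X)"
    using Suc by (intro vector_diff_chain_within shift) auto
  then have "((\<lambda>y. powr_fdiff m s y - powr_fdiff m s (y + 1)) has_vector_derivative
      (- s * powr_fdiff m (s + 1) x - (- s * powr_fdiff m (s + 1) (x + 1)))) (at x within X)"
    using Suc by (intro has_vector_derivative_diff) (auto simp: o_def)
  then show ?case by (simp add: algebra_simps)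
qed

text \<open>A difference of order \<open>m + 1\<close> is the increment over
  \<open>[x, x + 1]\<close> of one of order \<open>m\<close>, so the derivative bounds it: each
  order costs a factor \<open>norm s\<close> and gains a power of \<open>1 / x\<close>. The sum
  \<open>Re s + m\<close> is unchanged on passing from \<open>(m + 1, s)\<close> to
  \<open>(m, s + 1)\<close>; its nonnegativity makes the power of \<open>t\<close> non-increasing,
  so the left endpoint dominates. The base \<open>norm s + m\<close> absorbs the shift, since
  \<open>norm (s + 1) + m\<close> is at most \<open>norm s + (m + 1)\<close>.\<close>

lemma norm_powr_fdiff_le:
  assumes "x > 0" "Re s + real m \<ge> 0"
  shows "norm (powr_fdiff m s x) \<le> (norm s + real m) ^ m * x powr (- Re s - real m)"
  using assms
proof (induction m arbitrary: s x)
  case 0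
  then show ?case by (simp add: norm_powr_real_powr)
next
  case (Suc m)
  let ?B = "(norm s + real (Suc m)) ^ Suc m * x powr (- Re s - real (Suc m))"
  have bound: "norm (- s * powr_fdiff m (s + 1) t) \<le> ?B" if "t \<in> {x..x+1}" for t
  proof -
    have "norm (s + 1) \<le> norm s + 1"
      using norm_triangle_ineq[of s 1] by simp
    then have pow: "(norm (s + 1) + real m) ^ m \<le> (norm s + real (Suc m)) ^ m"
      by (intro power_mono) auto
    have "norm (powr_fdiff m (s + 1) t) \<le> (norm (s + 1) + real m) ^ m * t powr (- Re (s + 1) - real m)"
      using Suc.prems that by (intro Suc.IH) auto
    also have "\<dots> \<le> (norm s + real (Suc m)) ^ m * x powr (- Re (s + 1) - real m)"
      using Suc.prems that pow by (intro mult_mono powr_mono2') auto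
    finally have "norm s * norm (powr_fdiff m (s + 1) t) \<le>
        (norm s + real (Suc m)) * ((norm s + real (Suc m)) ^ m * x powr (- Re (s + 1) - real m))"
      by (intro mult_mono) auto
    moreover have "- Re (s + 1) - real m = - Re s - real (Suc m)" by simp
    ultimately show ?thesis by (simp only: norm_mult norm_minus_cancel power_Suc mult.assoc)
  qed
  have "norm (powr_fdiff m s (x + 1) - powr_fdiff m s x) \<le> ?B * norm (x + 1 - x)"
  proof (rule differentiable_bound[where S = "{x..x+1}"])
    fix t assume t: "t \<in> {x..x+1}"
    show "(powr_fdiff m s has_derivative (\<lambda>h. h *\<^sub>R (- s * powr_fdiff m (s + 1) t))) (at t within {x..x+1})"
      using has_vector_derivative_powr_fdiff[of t m s] t Suc.prems
      by (simp add: has_vector_derivative_def)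
    show "onorm (\<lambda>h. h *\<^sub>R (- s * powr_fdiff m (s + 1) t)) \<le> ?B"
    proof (rule onorm_le)
      fix h
      show "norm (h *\<^sub>R (- s * powr_fdiff m (s + 1) t)) \<le> ?B * norm h"
        unfolding norm_scaleR real_norm_def mult.commute[of "\<bar>h\<bar>"]
        by (intro mult_right_mono bound[OF t]) simp
    qed
  qed auto
  then show ?case by (simp add: norm_minus_commute)
qed

lemma powr_fdiff_holomorphic: "x > 0 \<Longrightarrow> (\<lambda>s. powr_fdiff m s x) holomorphic_on A"
proof (induction m arbitrary: x)
  case 0
  then show ?case by (auto intro!: holomorphic_intros simp: complex_nonpos_Reals_iff)
next
  case (Suc m)
  then show ?case by (auto intro!: holomorphic_intros)
qed

section \<open>Alternating series of the differences\<close>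

definition alt_powr_fdiff :: "nat \<Rightarrow> complex \<Rightarrow> complex" where
  "alt_powr_fdiff m s = (\<Sum>n. (-1) ^ n * powr_fdiff m s (real n + 1))"

lemma summable_powr_Suc: "a > 1 \<Longrightarrow> summable (\<lambda>n. (real n + 1) powr (-a))"
  using summable_Suc_iff[of "\<lambda>n. real n powr (-a)"]
  by (simp add: summable_real_powr_iff add.commute)

lemma summable_alt_powr_fdiff:
  assumes "Re s > 1 - real m"
  shows "summable (\<lambda>n. (-1) ^ n * powr_fdiff m s (real n + 1))"
proof (rule summable_comparison_test')
  show "summable (\<lambda>n. (norm s + real m) ^ m * (real n + 1) powr (- (Re s + real m)))"
    using assms by (intro summable_mult summable_powr_Suc) auto
  show "norm ((-1) ^ n * powr_fdiff m s (real n + 1)) \<le>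
      (norm s + real m) ^ m * (real n + 1) powr (- (Re s + real m))" if "n \<ge> 0" for n
    using norm_powr_fdiff_le[of "real n + 1" s m] assms by (simp add: norm_mult norm_power)
qed

lemma alt_powr_fdiff_holomorphic: "alt_powr_fdiff m holomorphic_on {s. Re s > 1 - real m}"
proof (rule holomorphic_uniform_sequence)
  show "open {s. Re s > 1 - real m}" by (rule open_halfspace_Re_gt)
  show "(\<lambda>s. \<Sum>n<k. (-1) ^ n * powr_fdiff m s (real n + 1)) holomorphic_on {s. Re s > 1 - real m}" for k
    by (intro holomorphic_intros powr_fdiff_holomorphic) auto
  fix z assume z: "z \<in> {s. Re s > 1 - real m}"
  \<comment> \<open>Half the distance from \<open>z\<close> to the line \<open>Re s = 1 - m\<close>,
    so that the decay exponent \<open>Re s + m\<close> stays at least \<open>1 + d\<close> on the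
    closed disc, as the M-test requires.\<close>
  define d where "d = (Re z + real m - 1) / 2"
  have d: "d > 0" using z by (simp add: d_def)
  have cball: "Re s + real m \<ge> 1 + d" "norm s \<le> norm z + d" if "s \<in> cball z d" for s
  proof -
    have "norm (z - s) \<le> d" using that by (simp add: dist_norm)
    then show "Re s + real m \<ge> 1 + d" "norm s \<le> norm z + d"
      using abs_Re_le_cmod[of "z - s"] norm_triangle_ineq4[of z "z - s"] by (auto simp: d_def field_simps abs_le_iff)
  qed
  have "uniform_limit (cball z d) (\<lambda>k s. \<Sum>n<k. (-1) ^ n * powr_fdiff m s (real n + 1))
      (alt_powr_fdiff m) sequentially"
    unfolding alt_powr_fdiff_def
  proof (rule Weierstrass_m_test)
    show "summable (\<lambda>n. (norm z + d + real m) ^ m * (real n + 1) powr (- (1 + d)))"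
      using d by (intro summable_mult summable_powr_Suc) auto
    fix n s assume s: "s \<in> cball z d"
    have "norm (powr_fdiff m s (real n + 1)) \<le>
        (norm s + real m) ^ m * (real n + 1) powr (- Re s - real m)"
      using cball[OF s] d by (intro norm_powr_fdiff_le) auto
    also have "\<dots> \<le> (norm z + d + real m) ^ m * (real n + 1) powr (- (1 + d))"
      using cball[OF s] d by (intro mult_mono power_mono powr_mono) auto
    finally show "norm ((-1) ^ n * powr_fdiff m s (real n + 1)) \<le>
        (norm z + d + real m) ^ m * (real n + 1) powr (- (1 + d))"
      by (simp add: norm_mult norm_power)
  qed
  moreover have "cball z d \<subseteq> {s. Re s > 1 - real m}"
    using cball(1) d by force
  ultimately show "\<exists>d>0. cball z d \<subseteq> {s. Re s > 1 - real m} \<and>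
      uniform_limit (cball z d) (\<lambda>k s. \<Sum>n<k. (-1) ^ n * powr_fdiff m s (real n + 1))
        (alt_powr_fdiff m) sequentially"
    using d by blast
qed

text \<open>Shifting the index of an alternating series flips its sign and drops the first term, so
  subtracting the shifted series doubles it up to that term. Solved for the series of order
  \<open>m\<close>, this is one Euler step: half the first term plus half the series of order
  \<open>m + 1\<close>.\<close>

lemma alt_powr_fdiff_Suc:
  assumes "Re s > 1 - real m"
  shows "alt_powr_fdiff (Suc m) s = 2 * alt_powr_fdiff m s - powr_fdiff m s 1"
proof -
  let ?f = "\<lambda>n. (-1) ^ n * powr_fdiff m s (real n + 1)"
  have f: "?f sums alt_powr_fdiff m s"
    using summable_alt_powr_fdiff[OF assms] by (simp add: alt_powr_fdiff_def summable_sums)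
  then have "(\<lambda>n. ?f (Suc n)) sums (alt_powr_fdiff m s - powr_fdiff m s 1)"
    by (subst sums_Suc_iff) simp
  from sums_add[OF f this]
  have "(\<lambda>n. (-1) ^ n * powr_fdiff (Suc m) s (real n + 1)) sums
      (2 * alt_powr_fdiff m s - powr_fdiff m s 1)"
    by (simp add: algebra_simps)
  then show ?thesis
    by (simp only: alt_powr_fdiff_def[of "Suc m"] sums_unique[symmetric])
qed

section \<open>The eta function as an entire function\<close>

text \<open>The \<open>m\<close>-fold Euler transform of \<open>\<Sum>n. (-1) ^ n * (n + 1) powr (-s)\<close>.\<close>

definition eta_approx :: "nat \<Rightarrow> complex \<Rightarrow> complex" where
  "eta_approx m s = (\<Sum>j<m. powr_fdiff j s 1 / 2 ^ Suc j) + alt_powr_fdiff m s / 2 ^ m"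

text \<open>The order, taken separately at each \<open>s\<close>, is at least
  \<open>2 - Re s\<close>, which puts \<open>s\<close> inside the half-plane
  \<open>Re s > 1 - m\<close> of convergence.\<close>

definition dirichlet_eta :: "complex \<Rightarrow> complex" where
  "dirichlet_eta s = eta_approx (nat \<lceil>2 - Re s\<rceil>) s"

lemma eta_approx_Suc:
  assumes "Re s > 1 - real m"
  shows "eta_approx (Suc m) s = eta_approx m s"
  using alt_powr_fdiff_Suc[OF assms] by (simp add: eta_approx_def diff_divide_distrib)

lemma eta_approx_mono:
  assumes "m \<le> n" "Re s > 1 - real m"
  shows "eta_approx n s = eta_approx m s"
  using assms(1)
proof (induction n rule: dec_induct)
  case (step n)
  then show ?case using eta_approx_Suc[of n s] assms by simp
qed simp

text \<open>All admissible orders give the same value, so the order varying with \<open>s\<close>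
  may be replaced by a fixed one on a whole half-plane; holomorphy and special values are then read
  off there.\<close>

lemma dirichlet_eta_eq:
  assumes "Re s > 1 - real m"
  shows "dirichlet_eta s = eta_approx m s"
proof -
  have "Re s > 1 - real (nat \<lceil>2 - Re s\<rceil>)" by linarith
  then show ?thesis
    using assms eta_approx_mono[of m "nat \<lceil>2 - Re s\<rceil>" s] eta_approx_mono[of "nat \<lceil>2 - Re s\<rceil>" m s]
    by (cases "m \<le> nat \<lceil>2 - Re s\<rceil>") (simp_all add: dirichlet_eta_def)
qed

lemma dirichlet_eta_holomorphic: "dirichlet_eta holomorphic_on UNIV"
proof -
  have "dirichlet_eta holomorphic_on {s. Re s > 1 - real m}" for m
  proof (rule holomorphic_transform)
    show "eta_approx m holomorphic_on {s. Re s > 1 - real m}"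
      unfolding eta_approx_def
      by (intro holomorphic_intros powr_fdiff_holomorphic alt_powr_fdiff_holomorphic) auto
  qed (simp add: dirichlet_eta_eq)
  then have "dirichlet_eta holomorphic_on (\<Union>m. {s. Re s > 1 - real m})"
    by (intro holomorphic_on_UN_open open_halfspace_Re_gt) auto
  moreover have "(\<Union>m. {s. Re s > 1 - real m}) = UNIV"
  proof -
    have "\<exists>m. Re s > 1 - real m" for s
      using reals_Archimedean2[of "1 - Re s"] by (auto simp: algebra_simps)
    then show ?thesis by auto
  qed
  ultimately show ?thesis by simp
qed

lemma dirichlet_eta_0: "dirichlet_eta 0 = 1 / 2"
proof -
  \<comment> \<open>At \<open>s = 0\<close> the undifferenced function is constantly 1 for positive
    \<open>x\<close>.\<close>
  have diff: "powr_fdiff (Suc m) 0 x = 0" if "x > 0" for m x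
    using that
  proof (induction m arbitrary: x)
    case 0
    then have "complex_of_real x \<noteq> 0" "complex_of_real (x + 1) \<noteq> 0"
      unfolding of_real_eq_0_iff by linarith+
    then show ?case by (simp del: of_real_add of_real_eq_0_iff)
  next
    case (Suc m)
    have "powr_fdiff (Suc m) 0 x = 0" "powr_fdiff (Suc m) 0 (x + 1) = 0"
      by (rule Suc.IH, use Suc.prems in simp)+
    then show ?case by (subst powr_fdiff.simps(2)) (simp del: powr_fdiff.simps)
  qed
  \<comment> \<open>Order 2 is the least with \<open>0 > 1 - m\<close>. Of the finite part only the
    term \<open>j = 0\<close> survives, with value \<open>1 / 2\<close>.\<close>
  have "alt_powr_fdiff (Suc (Suc 0)) 0 = 0"
    by (simp add: alt_powr_fdiff_def diff del: powr_fdiff.simps)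
  moreover have "dirichlet_eta 0 = eta_approx (Suc (Suc 0)) 0"
    by (rule dirichlet_eta_eq) simp
  ultimately show ?thesis
    by (simp add: eta_approx_def)
qed

text \<open>Subtracting twice the terms of even base from the zeta series makes the signs alternate,
  and those terms alone sum to \<open>2 powr (-s)\<close> times the whole series.\<close>

lemma dirichlet_eta_eq_zeta_series:
  assumes "Re s > 1"
  shows "dirichlet_eta s = (1 - 2 powr (1 - s)) * (\<Sum>n. 1 / of_nat (Suc n) powr s)"
proof -
  let ?f = "\<lambda>n. 1 / of_nat (Suc n) powr s :: complex"
  have f_eq: "?f n = powr_fdiff 0 s (real n + 1)" for n
    by (simp add: powr_minus_divide add.commute)
  have "summable ?f"
  proof (rule summable_comparison_test')
    show "summable (\<lambda>n. (real n + 1) powr (- Re s))"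
      using assms by (intro summable_powr_Suc)
    show "norm (?f n) \<le> (real n + 1) powr (- Re s)" if "n \<ge> 0" for n
      unfolding f_eq using norm_powr_fdiff_le[of "real n + 1" s 0] assms by simp
  qed
  then have f: "?f sums suminf ?f" by (rule summable_sums)
  \<comment> \<open>Index \<open>n\<close> carries the base \<open>n + 1\<close>, so the even bases
    \<open>2 * (k + 1)\<close> sit at the odd indices \<open>2 * k + 1\<close>.\<close>
  have "(\<lambda>n. if even n then 0 else 2 powr (-s) * ?f ((n - 1) div 2)) sums (2 powr (-s) * suminf ?f)"
    using sums_mult[OF f, of "2 powr (-s)"]
    by (subst sums_mono_reindex[of "\<lambda>k. 2 * k + 1", symmetric])
      (auto simp: strict_mono_def elim!: oddE)
  then have "(\<lambda>n. ?f n - 2 * (if even n then 0 else 2 powr (-s) * ?f ((n - 1) div 2))) sums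
      (suminf ?f - 2 * (2 powr (-s) * suminf ?f))"
    by (intro sums_diff sums_mult f)
  moreover have "?f n - 2 * (if even n then 0 else 2 powr (-s) * ?f ((n - 1) div 2)) =
      (-1) ^ n * powr_fdiff 0 s (real n + 1)" for n
  proof (cases "even n")
    case False
    then obtain k where k: "n = 2 * k + 1" by (elim oddE)
    have "of_nat (Suc n) powr s = (of_real 2 * of_real (real (Suc k)) :: complex) powr s"
      by (simp add: k algebra_simps)
    also have "\<dots> = 2 powr s * of_nat (Suc k) powr s"
      by (subst powr_times_real) auto
    finally have half: "?f n = 2 powr (-s) * ?f k"
      by (simp add: powr_minus_divide)
    have "(n - 1) div 2 = k" by (simp add: k)
    then show ?thesis unfolding f_eq[symmetric] using False half by simp
  qed (simp add: f_eq del: of_nat_Suc powr_fdiff.simps)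
  ultimately have "alt_powr_fdiff 0 s = suminf ?f - 2 * (2 powr (-s) * suminf ?f)"
    by (simp only: alt_powr_fdiff_def sums_unique[symmetric])
  moreover have "2 powr (1 - s) = 2 * 2 powr (- s :: complex)"
    by (simp add: powr_diff powr_minus_divide)
  moreover have "dirichlet_eta s = eta_approx 0 s"
    using assms by (intro dirichlet_eta_eq) simp
  ultimately show ?thesis by (simp add: eta_approx_def algebra_simps)
qed

section \<open>Uniqueness of the continuation and the value of zeta at 0\<close>

text \<open>The identity theorem is applied to the difference with its singularities removed, as
  poles of \<open>f\<close> and \<open>g\<close> may cancel and leave a wrong value. This gives
  equality near each point; the germ on a punctured neighbourhood then fixes the value, namely the
  limit or, at a pole, 0.\<close>

lemma nicely_meromorphic_unique:
  assumes f: "f nicely_meromorphic_on A" and g: "g nicely_meromorphic_on A"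
    and A: "open A" "connected A" "z \<in> A" and freq: "frequently (\<lambda>w. f w = g w) (at z)"
    and w: "w \<in> A"
  shows "f w = g w"
proof -
  have mero: "(\<lambda>w. f w - g w) meromorphic_on A"
    using f g by (auto simp: nicely_meromorphic_on_def intro!: meromorphic_intros)
  let ?h = "remove_sings (\<lambda>w. f w - g w)"
  have ev: "eventually (\<lambda>w. ?h w = f w - g w) (at x)" if "x \<in> A" for x
    using mero that by (intro eventually_remove_sings_eq_at meromorphic_on_isolated_singularity)
      (auto intro: meromorphic_on_subset)
  have "frequently (\<lambda>w. ?h w = 0) (at z)"
    using frequently_eventually_frequently[OF freq ev[OF \<open>z \<in> A\<close>]]
    by (rule frequently_elim1) auto
  then have h0: "?h x = 0" if "x \<in> A" for x
    using frequently_eq_meromorphic_imp_constant[of ?h 0 z A x]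
      remove_sings_nicely_meromorphic[OF mero] A that by blast
  have "eventually (\<lambda>x. x \<in> A) (at w)"
    using A w by (intro eventually_at_in_open') auto
  with ev[OF w] have eq: "eventually (\<lambda>x. f x = g x) (at w)"
    by eventually_elim (use h0 in auto)
  have lim_eq: "(f \<midarrow>w\<rightarrow> c) \<longleftrightarrow> (g \<midarrow>w\<rightarrow> c)" for c
    by (intro filterlim_cong eq refl)
  have pole_eq: "is_pole f w \<longleftrightarrow> is_pole g w"
    by (intro is_pole_cong eq refl)
  show ?thesis
  proof (cases "is_pole f w")
    case True
    \<comment> \<open>A function with a pole has no finite limit, which leaves only the convention
      of value 0 for both.\<close>
    then have "\<not> f \<midarrow>w\<rightarrow> f w" "\<not> g \<midarrow>w\<rightarrow> g w"
      using pole_eq not_tendsto_and_filterlim_at_infinity[OF at_neq_bot]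
      unfolding is_pole_def by blast+
    then show ?thesis
      using f g w unfolding nicely_meromorphic_on_def by metis
  next
    case False
    then have "f \<midarrow>w\<rightarrow> f w" "f \<midarrow>w\<rightarrow> g w"
      using f g w pole_eq lim_eq by (auto simp: nicely_meromorphic_on_def)
    then show ?thesis by (rule LIM_unique)
  qed
qed

lemma riemann_zeta_unique:
  assumes "f nicely_meromorphic_on UNIV"
    and "\<And>s. Re s > 1 \<Longrightarrow> f s = (\<Sum>n. 1 / of_nat (Suc n) powr s)"
  shows "riemann_zeta = f"
  unfolding riemann_zeta_def
proof (rule the_equality)
  fix g :: "complex \<Rightarrow> complex"
  assume g: "g nicely_meromorphic_on UNIV \<and>
    (\<forall>s. Re s > 1 \<longrightarrow> g s = (\<Sum>n. 1 / of_nat (Suc n) powr s))"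
  have "eventually (\<lambda>s. s \<in> {s. Re s > 1}) (at 2)"
    by (intro eventually_at_in_open' open_halfspace_Re_gt) auto
  then have "eventually (\<lambda>s. g s = f s) (at 2)"
    by eventually_elim (use g assms in auto)
  then have "frequently (\<lambda>s. g s = f s) (at 2)"
    by (intro eventually_frequently) auto
  then show "g = f"
    using g assms(1) by (intro ext nicely_meromorphic_unique[of g UNIV f 2]) auto
qed (use assms in auto)

text \<open>The denominator vanishes at \<open>1 + 2 * pi * i * k / ln 2\<close> for every integer
  \<open>k\<close>; \<open>remove_sings\<close> normalises the values at these points. None of them
  lies in \<open>Re s > 1\<close>, where the quotient is the series.\<close>

lemma riemann_zeta_eq: "riemann_zeta = remove_sings (\<lambda>s. dirichlet_eta s / (1 - 2 powr (1 - s)))"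
proof (rule riemann_zeta_unique)
  have eta: "dirichlet_eta analytic_on A" for A
    using dirichlet_eta_holomorphic by (meson analytic_on_holomorphic open_UNIV subset_UNIV)
  have den: "(\<lambda>s. 1 - 2 powr (1 - s) :: complex) analytic_on A" for A
    by (intro analytic_intros) (auto simp: complex_nonpos_Reals_iff)
  show "remove_sings (\<lambda>s. dirichlet_eta s / (1 - 2 powr (1 - s))) nicely_meromorphic_on UNIV"
    by (intro remove_sings_nicely_meromorphic meromorphic_on_divide analytic_on_imp_meromorphic_on
        eta den)
  fix s :: complex
  assume s: "Re s > 1"
  have "norm (2 powr (1 - s)) < 1"
    using s norm_powr_real_powr[of 2 "1 - s"] powr_less_cancel_iff[of 2 "1 - Re s" 0] by simp
  then have nz: "1 - 2 powr (1 - s) \<noteq> 0" by auto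
  have "(\<lambda>s. dirichlet_eta s / (1 - 2 powr (1 - s))) analytic_on {s}"
    using nz by (intro analytic_on_divide eta den) auto
  then show "remove_sings (\<lambda>s. dirichlet_eta s / (1 - 2 powr (1 - s))) s =
      (\<Sum>n. 1 / of_nat (Suc n) powr s)"
    using nz by (simp add: dirichlet_eta_eq_zeta_series[OF s])
qed

lemma riemann_zeta_0: "riemann_zeta 0 = - 1 / 2"
proof -
  \<comment> \<open>The denominator is \<open>1 - 2 = -1\<close> at 0, so nothing is altered there
    by \<open>remove_sings\<close>.\<close>
  have "(\<lambda>s. dirichlet_eta s / (1 - 2 powr (1 - s))) analytic_on {0}"
    using dirichlet_eta_holomorphic
    by (intro analytic_intros analytic_on_divide)
      (auto simp: complex_nonpos_Reals_iff intro: holomorphic_on_imp_analytic_at)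
  then show ?thesis
    by (simp add: riemann_zeta_eq dirichlet_eta_0)
qed

section \<open>The zeros of \<open>W\<close>\<close>

text \<open>
  Where \<open>Gamma (1 - s)\<close> may have a pole, the reflection formula exhibits \<open>W\<close> as a divisor of the
  nonvanishing function \<open>(2 * pi) powr s\<close>.
\<close>

lemma zeros_W_Re_nonpos:
  assumes "z \<in> zeros W"
  shows "Re z \<le> 0"
proof (rule ccontr)
  assume "\<not> Re z \<le> 0"
  then have z: "Re z > 0" by simp
  have an: "W analytic_on {z}" "W z = 0" using assms by (auto simp: zeros_def)
  let ?F = "\<lambda>s. 2 powr s * of_real pi powr (s - 1) * sin (of_real pi * s / 2) * Gamma (1 - s) :: complex"
  let ?G = "\<lambda>s. 2 * cos (of_real pi * s / 2) * Gamma s * W s :: complex"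
  let ?E = "\<lambda>s. 2 powr s * of_real pi powr s :: complex"
  have "(\<lambda>s. inverse (rGamma (1 - s))) meromorphic_on UNIV"
    by (intro meromorphic_intros analytic_on_imp_meromorphic_on analytic_intros)
  moreover have "(\<lambda>s. 2 powr s * of_real pi powr (s - 1) * sin (of_real pi * s / 2) :: complex)
      meromorphic_on UNIV"
    by (intro analytic_on_imp_meromorphic_on analytic_intros) (auto simp: complex_nonpos_Reals_iff not_le)
  ultimately have "?F meromorphic_on UNIV"
    unfolding Gamma_def by (rule meromorphic_on_mult[rotated])
  then have "eventually (\<lambda>s. W s = ?F s) (at z)"
    unfolding W_def by (intro eventually_remove_sings_eq_at meromorphic_on_isolated_singularity)
      (auto intro: meromorphic_on_subset)
  moreover have "eventually (\<lambda>s. s \<in> {s. Re s > 0}) (at z)"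
    using z by (intro eventually_at_in_open' open_halfspace_Re_gt) auto
  \<comment> \<open>Off the integers \<open>sin (pi * s)\<close> is nonzero and can be cancelled in
    the reflection formula. A punctured neighbourhood suffices, since only limits at
    \<open>z\<close> are compared.\<close>
  moreover have "eventually (\<lambda>s. s \<notin> \<int>) (at z)"
  proof -
    have "\<not> z islimpt \<int>"
      by (rule discrete_imp_not_islimpt[of 1]) (auto elim!: Ints_cases simp: dist_of_int)
    then show ?thesis by (simp add: islimpt_iff_eventually)
  qed
  ultimately have "eventually (\<lambda>s. ?G s = ?E s) (at z)"
  proof eventually_elim
    case (elim s)
    have "sin (of_real pi * s) = 2 * sin (of_real pi * s / 2) * cos (of_real pi * s / 2)"
      using sin_double[of "of_real pi * s / 2"] by simp
    moreover have "sin (of_real pi * s) \<noteq> 0"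
      using elim by (auto simp: sin_eq_0)
    moreover have "of_real pi powr s = of_real pi * (of_real pi powr (s - 1) :: complex)"
      by (simp add: powr_diff)
    ultimately show ?case
      using elim Gamma_reflection_complex[of s] by (simp add: field_simps)
  qed
  \<comment> \<open>Since \<open>Re z > 0\<close>, \<open>z\<close> is no pole of
    \<open>Gamma\<close>; thus \<open>W z = 0\<close> forces the limit 0, whereas \<open>?E\<close>
    is continuous and nonzero.\<close>
  moreover have "isCont ?G z"
    using z an by (intro continuous_intros analytic_at_imp_isCont an) (auto elim!: nonpos_Ints_cases)
  then have "?G \<midarrow>z\<rightarrow> 0"
    using an by (simp add: isCont_def)
  ultimately have "?E \<midarrow>z\<rightarrow> 0"
    by (simp cong: filterlim_cong)
  moreover have "isCont ?E z"
    by (intro continuous_intros) auto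
  ultimately have "?E z = 0"
    by (meson LIM_unique isCont_def)
  then show False by simp
qed

text \<open>On \<open>Re z \<le> 0\<close> the factor \<open>Gamma (1 - z)\<close> is analytic and
  nonzero, so the zeros there are exactly those of the sine; the open right half-plane is excluded
  by \<open>zeros_W_Re_nonpos\<close>.\<close>

lemma zeros_W: "zeros W = {- 2 * of_nat n | n :: nat. True}"
proof -
  have an: "W analytic_on {z}" "W z = 2 powr z * of_real pi powr (z - 1) * sin (of_real pi * z / 2) * Gamma (1 - z)"
    and G: "Gamma (1 - z) \<noteq> 0" if "Re z \<le> 0" for z :: complex
  proof -
    have z: "1 - z \<notin> \<int>\<^sub>\<le>\<^sub>0" using that by (auto elim!: nonpos_Ints_cases simp: complex_eq_iff)
    then have "(\<lambda>s. 2 powr s * of_real pi powr (s - 1) * sin (of_real pi * s / 2) * Gamma (1 - s) :: complex)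
        analytic_on {z}"
      by (intro analytic_intros) (auto simp: complex_nonpos_Reals_iff not_le)
    then show "W analytic_on {z}" "W z = 2 powr z * of_real pi powr (z - 1) * sin (of_real pi * z / 2) * Gamma (1 - z)"
      unfolding W_def by (auto simp: remove_sings_analytic_on)
    show "Gamma (1 - z) \<noteq> 0" using z by (simp add: Gamma_eq_zero_iff)
  qed
  show ?thesis
  proof (intro equalityI subsetI)
    fix z assume z: "z \<in> zeros W"
    then have re: "Re z \<le> 0" by (rule zeros_W_Re_nonpos)
    have "W z = 0" using z by (simp add: zeros_def)
    then have "sin (of_real pi * z / 2) = 0" using an(2)[OF re] G[OF re] by simp
    then obtain k :: int where k: "of_real pi * z / 2 = of_real (of_int k * pi)"
      by (auto simp: sin_eq_0)
    then have zk: "z = 2 * of_int k" by (simp add: field_simps)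
    with re have "z = - 2 * of_nat (nat (- k))" by simp
    then show "z \<in> {- 2 * of_nat n | n :: nat. True}" by blast
  next
    fix z :: complex assume "z \<in> {- 2 * of_nat n | n :: nat. True}"
    then obtain n where n: "z = - 2 * of_nat n" by blast
    then have re: "Re z \<le> 0" by simp
    have "sin (of_real pi * z / 2) = 0" by (auto simp: n sin_eq_0 intro: exI[of _ "int n"])
    then show "z \<in> zeros W" using an[OF re] by (simp add: zeros_def)
  qed
qed

theorem lemma1:
  shows "zeros W = {- 2 * of_nat n | n :: nat. True}
    \<and> trivial_zeta_zeros \<subseteq> zeros W
    \<and> zeros W \<inter> nontrivial_zeta_zeros = {}"
proof (intro conjI)
  show "zeros W = {- 2 * of_nat n | n :: nat. True}" by (rule zeros_W)
  show "trivial_zeta_zeros \<subseteq> zeros W" by (auto simp: zeros_W trivial_zeta_zeros_def)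
  \<comment> \<open>The two lists of even integers differ only in \<open>n = 0\<close>.\<close>
  have "z = 0" if z: "z \<in> zeros W" "z \<notin> trivial_zeta_zeros" for z
  proof -
    obtain n :: nat where n: "z = - 2 * of_nat n" using z(1) zeros_W by auto
    with z(2) have "\<not> n \<ge> 1" by (auto simp: trivial_zeta_zeros_def)
    with n show ?thesis by simp
  qed
  moreover have "0 \<notin> zeros riemann_zeta" by (simp add: zeros_def riemann_zeta_0)
  ultimately show "zeros W \<inter> nontrivial_zeta_zeros = {}"
    by (auto simp: nontrivial_zeta_zeros_def)
qed

end
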